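(* Let $\mathbf{x}=x_0x_1x_2\cdots$ be a $k$-automatic sequence for some integer $k\ge 2$. For each of the following properties of finite words — closed, palindromic, rich, privileged, trapezoidal, balanced — the property that a factor of $\mathbf{x}$ has it is expressible in first-order logic, more precisely in the theory $\mathrm{Th}(\mathbb{N},+,n\mapsto \mathbf{x}[n])$; that is, there is a first-order formula $\varphi(i,n)$ with two free variables, over the structure $(\mathbb{N},+,n\mapsto \mathbf{x}[n])$, such that for all $i,n\in\mathbb{N}$, $\varphi(i,n)$ holds if and only if the word $\mathbf{x}[i..i+n-1]$ has the property. The same holds for some analogs of $k$-automatic sequences, such as the Fibonacci-automatic sequences: if $\mathbf{x}$ is Fibonacci-automatic, then each of the six properties of factors of $\mathbf{x}$ is likewise expressible in $\mathrm{Th}(\mathbb{N},+,n\mapsto \mathbf{x}[n])$.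
   Context: Infinite words are indexed from $0$; $\mathbf{x}[i..j]=x_ix_{i+1}\cdots x_j$ for $j\ge i-1$ (empty if $j=i-1$), and $\mathbf{x}[n]=x_n$. A sequence over a finite alphabet is $k$-automatic if there is a deterministic finite automaton with output that, on reading the base-$k$ representation of $n$, outputs $x_n$. It is Fibonacci-automatic if there is a deterministic finite automaton with output that, on reading the Zeckendorf representation of $n$ (the representation of $n$ as a sum of distinct, pairwise non-consecutive Fibonacci numbers, written as a binary string), outputs $x_n$. First-order formulas over $(\mathbb{N},+,n\mapsto\mathbf{x}[n])$ use quantifiers over $\mathbb{N}$, Boolean connectives, equality, addition, and atomic tests on the values of the letters $\mathbf{x}[n]$ (i.e. a unary predicate $\{n: x_n=a\}$ for each letter $a$). Definitions for finite words. $|x|$ is the length of $x$, $|x|_w$ is the number of (possibly overlapping) occurrences of $w$ as a factor (contiguous block) of $x$, and $x^R$ is the reversal of $x$. The empty word is a factor of every word. A nonempty word $w$ is a border of $x$ if $w$ is both a prefix and a suffix of $x$. - Palindrome: $x=x^R$. - Rich: $x$ has exactly $|x|+1$ distinct palindromic factors (including the empty word). - Closed: $|x|\le 1$, or $x$ has a border $w$ with $|x|_w=2$. - Privileged (recursive): $|x|\le 1$, or $x$ has a border $w$ with $|x|_w=2$ that is itself privileged. - Trapezoidal: for each $m\ge 0$, $x$ has at most $m+1$ distinct factors of length $m$. - Balanced: for all factors $y,z$ of $x$ of the same length and all letters $a$, $\bigl||y|_a-|z|_a\bigr|\le 1$. *)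

theory Defs
  imports "HOL-Library.Sublist" "HOL-Number_Theory.Fib"
begin

section \<open>Properties of finite words\<close>

text \<open>Words are lists; \<open>sublist\<close> of \<^theory>\<open>HOL-Library.Sublist\<close> is the contiguous-factor relation.\<close>

definition occurrences :: "'a list \<Rightarrow> 'a list \<Rightarrow> nat" where
  "occurrences w x = card {i. i + length w \<le> length x \<and> take (length w) (drop i x) = w}"

definition border :: "'a list \<Rightarrow> 'a list \<Rightarrow> bool" where
  "border w x \<longleftrightarrow> w \<noteq> [] \<and> prefix w x \<and> suffix w x"

definition palindromic :: "'a list \<Rightarrow> bool" where
  "palindromic x \<longleftrightarrow> x = rev x"

definition rich :: "'a list \<Rightarrow> bool" where
  "rich x \<longleftrightarrow> card {p. sublist p x \<and> palindromic p} = length x + 1"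

definition closed_word :: "'a list \<Rightarrow> bool" where
  "closed_word x \<longleftrightarrow> length x \<le> 1 \<or> (\<exists>w. border w x \<and> occurrences w x = 2)"

text \<open>The recursion is well-founded, since \<open>occurrences x x = 1\<close> forces the border
  in the second rule to be shorter than the word; hence least and greatest solution agree.\<close>

inductive privileged :: "'a list \<Rightarrow> bool" where
  short: "length x \<le> 1 \<Longrightarrow> privileged x"
| border: "border w x \<Longrightarrow> occurrences w x = 2 \<Longrightarrow> privileged w \<Longrightarrow> privileged x"

definition trapezoidal :: "'a list \<Rightarrow> bool" where
  "trapezoidal x \<longleftrightarrow> (\<forall>m. card {w. sublist w x \<and> length w = m} \<le> m + 1)"

definition balanced :: "'a list \<Rightarrow> bool" where
  "balanced x \<longleftrightarrow> (\<forall>y z a. sublist y x \<and> sublist z x \<and> length y = length z \<longrightarrow>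
     \<bar>int (count_list y a) - int (count_list z a)\<bar> \<le> 1)"

section \<open>Automatic sequences\<close>

text \<open>States are natural numbers: every finite automaton is isomorphic to one of these,
  and HOL definitions cannot quantify existentially over types.\<close>

record 'a dfao =
  states :: "nat set"
  init :: nat
  trans :: "nat \<Rightarrow> nat \<Rightarrow> nat"
  out :: "nat \<Rightarrow> 'a"

definition is_dfao :: "nat set \<Rightarrow> 'a dfao \<Rightarrow> bool" where
  "is_dfao D M \<longleftrightarrow> finite (states M) \<and> init M \<in> states M \<and>
     (\<forall>q\<in>states M. \<forall>d\<in>D. trans M q d \<in> states M)"

definition dfao_output :: "'a dfao \<Rightarrow> nat list \<Rightarrow> 'a" where
  "dfao_output M w = out M (foldl (trans M) (init M) w)"

text \<open>Representations are read most significant digit first and have no leading zeros,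
  so that 0 is represented by the empty word.\<close>

definition positional_value :: "(nat \<Rightarrow> nat) \<Rightarrow> nat list \<Rightarrow> nat" where
  "positional_value U w = (\<Sum>i<length w. rev w ! i * U i)"

definition base_rep :: "nat \<Rightarrow> nat \<Rightarrow> nat list \<Rightarrow> bool" where
  "base_rep k n w \<longleftrightarrow> set w \<subseteq> {..<k} \<and> (w \<noteq> [] \<longrightarrow> hd w \<noteq> 0) \<and>
     positional_value (\<lambda>i. k ^ i) w = n"

text \<open>The shift by 2 selects the Fibonacci numbers 1, 2, 3, 5, 8, \<open>\<dots>\<close> as place values.\<close>

definition zeckendorf_rep :: "nat \<Rightarrow> nat list \<Rightarrow> bool" where
  "zeckendorf_rep n w \<longleftrightarrow> set w \<subseteq> {0, 1} \<and> (w \<noteq> [] \<longrightarrow> hd w \<noteq> 0) \<and>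
     \<not> sublist [1, 1] w \<and> positional_value (\<lambda>i. fib (i + 2)) w = n"

definition k_automatic :: "nat \<Rightarrow> (nat \<Rightarrow> 'a) \<Rightarrow> bool" where
  "k_automatic k x \<longleftrightarrow>
     (\<exists>M. is_dfao {..<k} M \<and> (\<forall>n w. base_rep k n w \<longrightarrow> dfao_output M w = x n))"

definition fibonacci_automatic :: "(nat \<Rightarrow> 'a) \<Rightarrow> bool" where
  "fibonacci_automatic x \<longleftrightarrow>
     (\<exists>M. is_dfao {0, 1} M \<and> (\<forall>n w. zeckendorf_rep n w \<longrightarrow> dfao_output M w = x n))"

section \<open>First-order logic over \<open>(\<nat>, +, n \<mapsto> x[n])\<close>\<close>

datatype tm = Var nat | Add tm tm

text \<open>\<open>Letter a t\<close> is the atomic test \<open>x[t] = a\<close>.\<close>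

datatype 'a fm =
    Eq tm tm
  | Letter 'a tm
  | Neg "'a fm"
  | And "'a fm" "'a fm"
  | Or "'a fm" "'a fm"
  | Imp "'a fm" "'a fm"
  | Ex nat "'a fm"
  | All nat "'a fm"

primrec tm_val :: "(nat \<Rightarrow> nat) \<Rightarrow> tm \<Rightarrow> nat" where
  "tm_val e (Var v) = e v"
| "tm_val e (Add s t) = tm_val e s + tm_val e t"

primrec sat :: "(nat \<Rightarrow> 'a) \<Rightarrow> (nat \<Rightarrow> nat) \<Rightarrow> 'a fm \<Rightarrow> bool" where
  "sat x e (Eq s t) \<longleftrightarrow> tm_val e s = tm_val e t"
| "sat x e (Letter a t) \<longleftrightarrow> x (tm_val e t) = a"
| "sat x e (Neg f) \<longleftrightarrow> \<not> sat x e f"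
| "sat x e (And f g) \<longleftrightarrow> sat x e f \<and> sat x e g"
| "sat x e (Or f g) \<longleftrightarrow> sat x e f \<or> sat x e g"
| "sat x e (Imp f g) \<longleftrightarrow> (sat x e f \<longrightarrow> sat x e g)"
| "sat x e (Ex v f) \<longleftrightarrow> (\<exists>m. sat x (e(v := m)) f)"
| "sat x e (All v f) \<longleftrightarrow> (\<forall>m. sat x (e(v := m)) f)"

primrec tm_vars :: "tm \<Rightarrow> nat set" where
  "tm_vars (Var v) = {v}"
| "tm_vars (Add s t) = tm_vars s \<union> tm_vars t"

primrec free_vars :: "'a fm \<Rightarrow> nat set" where
  "free_vars (Eq s t) = tm_vars s \<union> tm_vars t"
| "free_vars (Letter a t) = tm_vars t"
| "free_vars (Neg f) = free_vars f"
| "free_vars (And f g) = free_vars f \<union> free_vars g"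
| "free_vars (Or f g) = free_vars f \<union> free_vars g"
| "free_vars (Imp f g) = free_vars f \<union> free_vars g"
| "free_vars (Ex v f) = free_vars f - {v}"
| "free_vars (All v f) = free_vars f - {v}"

text \<open>Variables 0 and 1 play the roles of \<open>i\<close> and \<open>n\<close>; the word \<open>map x [i..<i + n]\<close>
  is \<open>x[i..i+n-1]\<close>, empty for \<open>n = 0\<close>.\<close>

definition fo_expressible :: "(nat \<Rightarrow> 'a) \<Rightarrow> ('a list \<Rightarrow> bool) \<Rightarrow> bool" where
  "fo_expressible x P \<longleftrightarrow> (\<exists>\<phi>. free_vars \<phi> = {0, 1} \<and>
     (\<forall>e i n. e 0 = i \<and> e 1 = n \<longrightarrow> (sat x e \<phi> \<longleftrightarrow> P (map x [i..<i + n]))))"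

end

theory Submission
  imports Defs
begin

text \<open>Over a finite alphabet, each of the six properties can be stated in terms of positions,
  addition and letter equality. A word is rich iff each of its nonempty prefixes has a palindromic
  suffix that has not occurred before. A word \<open>w\<close> is privileged iff for each \<open>m\<close> with
  \<open>1 \<le> m < |w|\<close> some border of length at most \<open>m\<close> occurs only once in the first \<open>m\<close> letters and
  only once in the last \<open>m\<close> letters of \<open>w\<close>. A word is unbalanced iff, for some letter \<open>a\<close>, it has
  factors \<open>a u a\<close> and \<open>b v c\<close> with \<open>b, c \<noteq> a\<close> such that \<open>u\<close> and \<open>v\<close> have equal length and the
  letter \<open>a\<close> at the same places. A word is trapezoidal iff it has at most two letters and at most
  one right special factor of each length.\<close>

section \<open>First-order definable relations\<close>

text \<open>The first \<open>k\<close> variables are available, and quantifiers bind the next one.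
  Variable 2 always carries the value 1, which the language has no constant for.\<close>

definition definable :: "(nat \<Rightarrow> 'a) \<Rightarrow> nat \<Rightarrow> ((nat \<Rightarrow> nat) \<Rightarrow> bool) \<Rightarrow> bool" where
  "definable x k Q \<longleftrightarrow>
     (\<exists>\<phi>. free_vars \<phi> \<subseteq> {..<k} \<and> (\<forall>e. e 2 = 1 \<longrightarrow> (sat x e \<phi> \<longleftrightarrow> Q e)))"

text \<open>Terms are nonempty sums of variables, so positions have to be written without
  subtraction and without 0; the constant 1 enters through variable 2.\<close>

definition term_function :: "nat \<Rightarrow> ((nat \<Rightarrow> nat) \<Rightarrow> nat) \<Rightarrow> bool" where
  "term_function k t \<longleftrightarrow>
     (\<exists>s. tm_vars s \<subseteq> {..<k} \<and> (\<forall>e. e 2 = 1 \<longrightarrow> tm_val e s = t e))"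

named_theorems definable_intros

section \<open>Definability of atomic formulas, connectives and quantifiers\<close>

lemma tm_val_upd: "v \<notin> tm_vars s \<Longrightarrow> tm_val (e(v := m)) s = tm_val e s"
  by (induction s) auto

lemma term_function_var [definable_intros]: "v < k \<Longrightarrow> term_function k (\<lambda>e. e v)"
  unfolding term_function_def by (rule exI[of _ "Var v"]) auto

lemma term_function_one [definable_intros]: "3 \<le> k \<Longrightarrow> term_function k (\<lambda>e. 1)"
  unfolding term_function_def by (rule exI[of _ "Var 2"]) auto

lemma term_function_add [definable_intros]:
  assumes "term_function k s" "term_function k t"
  shows "term_function k (\<lambda>e. s e + t e)"
proof -
  obtain s' where "tm_vars s' \<subseteq> {..<k}" "\<And>e. e 2 = 1 \<Longrightarrow> tm_val e s' = s e"
    using assms(1) unfolding term_function_def by blast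
  moreover obtain t' where "tm_vars t' \<subseteq> {..<k}" "\<And>e. e 2 = 1 \<Longrightarrow> tm_val e t' = t e"
    using assms(2) unfolding term_function_def by blast
  ultimately show ?thesis
    unfolding term_function_def by (intro exI[of _ "Add s' t'"]) auto
qed

lemma definable_eq [definable_intros]:
  assumes "term_function k s" "term_function k t"
  shows "definable x k (\<lambda>e. s e = t e)"
proof -
  obtain s' where "tm_vars s' \<subseteq> {..<k}" "\<And>e. e 2 = 1 \<Longrightarrow> tm_val e s' = s e"
    using assms(1) unfolding term_function_def by blast
  moreover obtain t' where "tm_vars t' \<subseteq> {..<k}" "\<And>e. e 2 = 1 \<Longrightarrow> tm_val e t' = t e"
    using assms(2) unfolding term_function_def by blast
  ultimately show ?thesis
    unfolding definable_def by (intro exI[of _ "Eq s' t'"]) auto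
qed

lemma definable_letter [definable_intros]:
  assumes "term_function k t"
  shows "definable x k (\<lambda>e. x (t e) = a)"
proof -
  from assms obtain t' where "tm_vars t' \<subseteq> {..<k}" "\<And>e. e 2 = 1 \<Longrightarrow> tm_val e t' = t e"
    unfolding term_function_def by blast
  then show ?thesis
    unfolding definable_def by (intro exI[of _ "Letter a t'"]) auto
qed

lemma definable_not [definable_intros]:
  assumes "definable x k P"
  shows "definable x k (\<lambda>e. \<not> P e)"
proof -
  from assms obtain f where "free_vars f \<subseteq> {..<k}" "\<And>e. e 2 = 1 \<Longrightarrow> sat x e f \<longleftrightarrow> P e"
    unfolding definable_def by blast
  then show ?thesis
    unfolding definable_def by (intro exI[of _ "Neg f"]) auto
qed

lemma definable_conj [definable_intros]:
  assumes "definable x k P" "definable x k Q"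
  shows "definable x k (\<lambda>e. P e \<and> Q e)"
proof -
  obtain f where "free_vars f \<subseteq> {..<k}" "\<And>e. e 2 = 1 \<Longrightarrow> sat x e f \<longleftrightarrow> P e"
    using assms(1) unfolding definable_def by blast
  moreover obtain g where "free_vars g \<subseteq> {..<k}" "\<And>e. e 2 = 1 \<Longrightarrow> sat x e g \<longleftrightarrow> Q e"
    using assms(2) unfolding definable_def by blast
  ultimately show ?thesis
    unfolding definable_def by (intro exI[of _ "And f g"]) auto
qed

lemma definable_disj [definable_intros]:
  assumes "definable x k P" "definable x k Q"
  shows "definable x k (\<lambda>e. P e \<or> Q e)"
  using definable_not[OF definable_conj[OF definable_not[OF assms(1)] definable_not[OF assms(2)]]]
  by simp

lemma definable_imp [definable_intros]:
  assumes "definable x k P" "definable x k Q"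
  shows "definable x k (\<lambda>e. P e \<longrightarrow> Q e)"
  using definable_disj[OF definable_not[OF assms(1)] assms(2)] by simp

lemma definable_iff [definable_intros]:
  assumes "definable x k P" "definable x k Q"
  shows "definable x k (\<lambda>e. P e \<longleftrightarrow> Q e)"
  using definable_conj[OF definable_imp[OF assms] definable_imp[OF assms(2,1)]]
  unfolding iff_conv_conj_imp .

text \<open>Numbering bound variables by nesting depth makes \<open>k\<close> fresh for the new
  quantifier. The second premise says that overwriting entry \<open>k\<close> with the chosen value
  does not affect \<open>R m\<close>; \<open>3 \<le> k\<close> protects the value 1 of variable
  2.\<close>

lemma definable_ex [definable_intros]:
  assumes "3 \<le> k" "\<And>e m. R m (e(k := m)) = R m e" "definable x (Suc k) (\<lambda>e. R (e k) e)"
  shows "definable x k (\<lambda>e. \<exists>m. R m e)"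
proof -
  from assms(3) obtain f where f: "free_vars f \<subseteq> {..<Suc k}"
    "\<And>e. e 2 = 1 \<Longrightarrow> sat x e f \<longleftrightarrow> R (e k) e"
    unfolding definable_def by blast
  show ?thesis
    unfolding definable_def
  proof (intro exI[of _ "Ex k f"] conjI allI impI)
    show "free_vars (Ex k f) \<subseteq> {..<k}"
      using f(1) by (auto simp: less_Suc_eq)
    show "sat x e (Ex k f) \<longleftrightarrow> (\<exists>m. R m e)" if "e 2 = 1" for e
    proof -
      have "sat x (e(k := m)) f \<longleftrightarrow> R m e" for m
        using f(2)[of "e(k := m)"] assms(1,2) that by simp
      then show ?thesis by simp
    qed
  qed
qed

lemma definable_all [definable_intros]:
  assumes "3 \<le> k" "\<And>e m. R m (e(k := m)) = R m e" "definable x (Suc k) (\<lambda>e. R (e k) e)"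
  shows "definable x k (\<lambda>e. \<forall>m. R m e)"
proof -
  have "definable x k (\<lambda>e. \<not> (\<exists>m. \<not> R m e))"
    by (rule definable_not, rule definable_ex[where R = "\<lambda>m e. \<not> R m e"])
      (use assms in \<open>auto intro: definable_not\<close>)
  then show ?thesis by simp
qed

text \<open>Quantifiers of the logic range over numbers only; over a finite alphabet a quantifier
  over letters is a finite conjunction, built by induction on the set of letters.\<close>

lemma definable_all_letters [definable_intros]:
  fixes R :: "'b::finite \<Rightarrow> (nat \<Rightarrow> nat) \<Rightarrow> bool"
  assumes "3 \<le> k" "\<And>a. definable x k (R a)"
  shows "definable x k (\<lambda>e. \<forall>a. R a e)"
proof -
  have "definable x k (\<lambda>e. \<forall>a\<in>A. R a e)" if "finite A" for A
    using that
  proof induction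
    case empty
    \<comment> \<open>The language has no constant for truth; a trivial equation stands for the
      empty conjunction.\<close>
    have "definable x k (\<lambda>e. (1::nat) = 1)"
      using assms(1) by (intro definable_intros)
    then show ?case by simp
  next
    case (insert a A)
    have "definable x k (\<lambda>e. R a e \<and> (\<forall>a\<in>A. R a e))"
      by (intro definable_conj assms(2) insert.IH)
    then show ?case by simp
  qed
  from this[of UNIV] show ?thesis by simp
qed

text \<open>Atomic tests compare a position with a fixed letter, so two positions are compared by
  running through all letters.\<close>

lemma definable_letter_eq [definable_intros]:
  fixes x :: "nat \<Rightarrow> 'a::finite"
  assumes "3 \<le> k" "term_function k s" "term_function k t"
  shows "definable x k (\<lambda>e. x (s e) = x (t e))"
proof -
  have "definable x k (\<lambda>e. \<forall>a. x (s e) = a \<longrightarrow> x (t e) = a)"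
    by (intro definable_intros assms)
  then show ?thesis by (simp add: eq_commute)
qed

text \<open>The order comes from addition by quantifying over the difference; variable
  \<open>k\<close> occurs in neither term and can hold it.\<close>

lemma definable_le [definable_intros]:
  assumes "term_function k s" "term_function k t"
  shows "definable x k (\<lambda>e. s e \<le> t e)"
proof -
  obtain s' where s': "tm_vars s' \<subseteq> {..<k}" "\<And>e. e 2 = 1 \<Longrightarrow> tm_val e s' = s e"
    using assms(1) unfolding term_function_def by blast
  obtain t' where t': "tm_vars t' \<subseteq> {..<k}" "\<And>e. e 2 = 1 \<Longrightarrow> tm_val e t' = t e"
    using assms(2) unfolding term_function_def by blast
  from s'(1) t'(1) have "k \<notin> tm_vars s'" "k \<notin> tm_vars t'" by auto
  moreover have "(\<exists>m. a + m = b) \<longleftrightarrow> a \<le> b" for a b :: nat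
    by (metis le_iff_add)
  ultimately show ?thesis
    unfolding definable_def using s' t'
    by (intro exI[of _ "Ex k (Eq (Add s' (Var k)) t')"])
      (auto simp: tm_val_upd less_Suc_eq)
qed

lemma definable_less [definable_intros]:
  assumes "term_function k s" "term_function k t"
  shows "definable x k (\<lambda>e. s e < t e)"
  using definable_not[OF definable_le[OF assms(2,1)]] by (simp add: not_le)

section \<open>Factors of infinite words\<close>

definition factor_at :: "(nat \<Rightarrow> 'a) \<Rightarrow> nat \<Rightarrow> nat \<Rightarrow> 'a list" where
  "factor_at x i n = map x [i..<i + n]"

lemma length_factor_at [simp]: "length (factor_at x i n) = n"
  by (simp add: factor_at_def)

lemma nth_factor_at [simp]: "t < n \<Longrightarrow> factor_at x i n ! t = x (i + t)"
  by (simp add: factor_at_def)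

lemma factor_at_0 [simp]: "factor_at x i 0 = []"
  by (simp add: factor_at_def)

lemma factor_at_Suc: "factor_at x i (Suc n) = factor_at x i n @ [x (i + n)]"
  by (simp add: factor_at_def)

lemma factor_at_add: "factor_at x i (m + n) = factor_at x i m @ factor_at x (i + m) n"
  using upt_add_eq_append[of i "i + m" n] by (simp add: factor_at_def add.assoc)

lemma factor_at_eq_iff: "factor_at x i n = factor_at x j n \<longleftrightarrow> (\<forall>t<n. x (i + t) = x (j + t))"
  by (auto simp: list_eq_iff_nth_eq)

text \<open>Serves to move facts from one copy of a repeated factor to the other.\<close>

lemma factor_at_sub:
  assumes "factor_at x i n = factor_at x j n" "d + l \<le> n"
  shows "factor_at x (i + d) l = factor_at x (j + d) l"
  using assms by (auto simp: factor_at_eq_iff add.assoc)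

lemma take_drop_factor_at: "p + l \<le> n \<Longrightarrow> take l (drop p (factor_at x i n)) = factor_at x (i + p) l"
  by (auto simp: list_eq_iff_nth_eq add.assoc)

lemma prefix_factor_at_iff:
  "prefix u (factor_at x i n) \<longleftrightarrow> length u \<le> n \<and> u = factor_at x i (length u)"
proof
  assume "prefix u (factor_at x i n)"
  then have "length u \<le> n" "u = take (length u) (factor_at x i n)"
    by (auto simp: prefix_def dest: arg_cong[where f = length])
  then show "length u \<le> n \<and> u = factor_at x i (length u)"
    using take_drop_factor_at[of 0 "length u" n x i] by simp
next
  assume "length u \<le> n \<and> u = factor_at x i (length u)"
  then show "prefix u (factor_at x i n)"
    using factor_at_add[of x i "length u" "n - length u"] by (metis le_add_diff_inverse prefixI)
qed

lemma suffix_factor_at_iff: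
  "suffix u (factor_at x i n) \<longleftrightarrow> length u \<le> n \<and> u = factor_at x (i + n - length u) (length u)"
proof
  assume "suffix u (factor_at x i n)"
  then obtain v where v: "factor_at x i n = v @ u" by (auto simp: suffix_def)
  then have "n = length v + length u" by (metis length_append length_factor_at)
  with v show "length u \<le> n \<and> u = factor_at x (i + n - length u) (length u)"
    using factor_at_add[of x i "length v" "length u"] by auto
next
  assume "length u \<le> n \<and> u = factor_at x (i + n - length u) (length u)"
  then show "suffix u (factor_at x i n)"
    using factor_at_add[of x i "n - length u" "length u"]
    by (metis Nat.add_diff_assoc le_add_diff_inverse2 suffixI)
qed

lemma sublist_factor_at_iff:
  "sublist u (factor_at x i n) \<longleftrightarrow>
     (\<exists>j. i \<le> j \<and> j + length u \<le> i + n \<and> u = factor_at x j (length u))"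
proof
  assume "sublist u (factor_at x i n)"
  then obtain v v' where v: "factor_at x i n = v @ u @ v'" by (auto simp: sublist_def)
  then have "n = length v + (length u + length v')" by (metis length_append length_factor_at)
  with v have "u = factor_at x (i + length v) (length u)" "i + length v + length u \<le> i + n"
    by (auto simp: factor_at_add)
  then show "\<exists>j. i \<le> j \<and> j + length u \<le> i + n \<and> u = factor_at x j (length u)"
    by (intro exI[of _ "i + length v"]) auto
next
  assume "\<exists>j. i \<le> j \<and> j + length u \<le> i + n \<and> u = factor_at x j (length u)"
  then obtain j where j: "i \<le> j" "j + length u \<le> i + n" "u = factor_at x j (length u)" by blast
  then have "take (length u) (drop (j - i) (factor_at x i n)) = u"
    by (subst take_drop_factor_at) auto
  then show "sublist u (factor_at x i n)"
    by (metis sublist_drop sublist_order.order_trans sublist_take)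
qed

lemma occurrences_factor_at:
  "occurrences u (factor_at x i n) =
     card {j. i \<le> j \<and> j + length u \<le> i + n \<and> factor_at x j (length u) = u}"
  (is "_ = card ?B")
proof -
  let ?A = "{p. p + length u \<le> length (factor_at x i n) \<and>
                take (length u) (drop p (factor_at x i n)) = u}"
  have "?B = (\<lambda>p. i + p) ` ?A"
  proof (intro equalityI subsetI)
    fix j assume "j \<in> ?B"
    then show "j \<in> (\<lambda>p. i + p) ` ?A"
      by (intro image_eqI[of _ _ "j - i"]) (auto simp: take_drop_factor_at)
  qed (auto simp: take_drop_factor_at)
  then have "card ?B = card ?A"
    by (simp add: card_image)
  then show ?thesis by (simp add: occurrences_def)
qed

text \<open>Binding variable 2 and requiring it to be the least nonzero number discharges the
  convention that it carries 1. Zero is recognised by \<open>v + v = v\<close>.\<close>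

lemma fo_expressibleI:
  assumes "\<And>i n. P (factor_at x i n) \<longleftrightarrow> R i n" "definable x 3 (\<lambda>e. R (e 0) (e 1))"
  shows "fo_expressible x P"
proof -
  from assms(2) obtain f where f: "free_vars f \<subseteq> {..<3}"
    "\<And>e. e 2 = 1 \<Longrightarrow> sat x e f \<longleftrightarrow> R (e 0) (e 1)"
    unfolding definable_def by blast
  define zero :: "nat \<Rightarrow> 'a fm" where "zero v = Eq (Add (Var v) (Var v)) (Var v)" for v
  define one :: "'a fm" where
    "one = And (Neg (zero 2)) (All 3 (Or (zero 3) (Ex 4 (Eq (Add (Var 2) (Var 4)) (Var 3)))))"
  have one: "sat x e one \<longleftrightarrow> e 2 = 1" for e
  proof
    assume "sat x e one"
    \<comment> \<open>The instance of the universal quantifier at 1 bounds \<open>e 2\<close> from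
      above.\<close>
    then have "e 2 \<noteq> 0" "\<exists>m. e 2 + m = 1"
      by (auto simp: one_def zero_def)
    then show "e 2 = 1" by auto
  next
    assume "e 2 = 1"
    then show "sat x e one"
      by (auto simp: one_def zero_def) (metis not0_implies_Suc)
  qed
  \<comment> \<open>The two trivial equations make the free variables exactly 0 and 1, even if
    \<open>f\<close> does not mention both.\<close>
  define g where "g = And (And (Eq (Var 0) (Var 0)) (Eq (Var 1) (Var 1))) (Ex 2 (And one f))"
  have "free_vars f \<subseteq> {0, 1, 2}"
    using f(1) by (auto simp: eval_nat_numeral less_Suc_eq)
  then have "free_vars g = {0, 1}"
    by (auto simp: g_def one_def zero_def)
  moreover have "sat x e g \<longleftrightarrow> P (factor_at x i n)" if "e 0 = i \<and> e 1 = n" for e i n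
    using that f(2)[of "e(2 := 1)"] assms(1) by (auto simp: g_def one)
  ultimately show ?thesis
    unfolding fo_expressible_def factor_at_def by blast
qed

section \<open>Palindromic, closed and privileged words\<close>

text \<open>Mirror positions are described by their sum, which avoids subtraction.\<close>

lemma palindromic_factor_at_iff:
  "palindromic (factor_at x i n) \<longleftrightarrow> (\<forall>s t. s + t + 1 = n \<longrightarrow> x (i + s) = x (i + t))"
proof -
  have "palindromic (factor_at x i n) \<longleftrightarrow> (\<forall>s<n. x (i + s) = x (i + (n - Suc s)))"
    by (simp add: palindromic_def list_eq_iff_nth_eq rev_nth)
  also have "\<dots> \<longleftrightarrow> (\<forall>s t. s + t + 1 = n \<longrightarrow> x (i + s) = x (i + t))" (is "?L \<longleftrightarrow> ?R")
  proof
    assume L: ?L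
    show ?R
    proof (intro allI impI)
      fix s t assume "s + t + 1 = n"
      then have "s < n" "n - Suc s = t" by auto
      with L show "x (i + s) = x (i + t)" by blast
    qed
  next
    assume R: ?R
    show ?L
    proof (intro allI impI)
      fix s assume "s < n"
      then have "s + (n - Suc s) + 1 = n" by simp
      with R show "x (i + s) = x (i + (n - Suc s))" by blast
    qed
  qed
  finally show ?thesis .
qed

text \<open>A border always occurs at the start \<open>i\<close> and at the final position
  \<open>j\<close>. A count of 2 means that these differ and that no occurrence lies between
  them.\<close>

lemma border_twice_iff:
  "border u (factor_at x i n) \<and> occurrences u (factor_at x i n) = 2 \<longleftrightarrow>
     (\<exists>l j. 1 \<le> l \<and> i < j \<and> j + l = i + n \<and> u = factor_at x i l \<and> factor_at x j l = factor_at x i l \<and>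
        (\<forall>t. i < t \<and> t < j \<longrightarrow> factor_at x t l \<noteq> factor_at x i l))"
  (is "?L \<longleftrightarrow> ?R")
proof
  assume L: ?L
  define l where "l = length u"
  define j where "j = i + n - l"
  let ?S = "{t. i \<le> t \<and> t + l \<le> i + n \<and> factor_at x t l = u}"
  from L have "u \<noteq> []" "prefix u (factor_at x i n)" "suffix u (factor_at x i n)"
    by (simp_all add: border_def)
  then have u: "u \<noteq> []" "l \<le> n" "u = factor_at x i l" "u = factor_at x j l"
    unfolding prefix_factor_at_iff suffix_factor_at_iff l_def j_def by blast+
  have jl: "j + l = i + n" using u(2) by (simp add: j_def)
  have card: "card ?S = 2" using L by (simp add: occurrences_factor_at l_def)
  have fin: "finite ?S" using card by (metis card.infinite zero_neq_numeral)
  have mem: "i \<in> ?S" "j \<in> ?S"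
    using jl u(2) u(3,4)[symmetric] by simp_all
  \<comment> \<open>Otherwise the border would fill the word and \<open>i\<close> would be its only
    starting position.\<close>
  have "i < j"
  proof (rule ccontr)
    assume "\<not> i < j"
    then have "?S \<subseteq> {i}" using jl by auto
    then have "card ?S \<le> 1" using card_mono[of "{i}" ?S] by simp
    with card show False by simp
  qed
  then have S: "?S = {i, j}"
    using card_subset_eq[OF fin, of "{i, j}"] mem card by auto
  have "factor_at x t l \<noteq> factor_at x i l" if "i < t" "t < j" for t
  proof
    assume "factor_at x t l = factor_at x i l"
    with that have "t \<in> ?S" using jl u(3) by simp
    then have "t \<in> {i, j}" unfolding S .
    with that show False by simp
  qed
  moreover have "1 \<le> l" using u(1) by (simp add: l_def Suc_le_eq)
  moreover have "factor_at x j l = factor_at x i l" using u(3,4) by simp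
  ultimately show ?R
    using \<open>i < j\<close> jl u(3) by blast
next
  assume ?R
  then obtain l j where lj: "1 \<le> l" "i < j" "j + l = i + n" "u = factor_at x i l"
    "factor_at x j l = factor_at x i l"
    "\<And>t. i < t \<Longrightarrow> t < j \<Longrightarrow> factor_at x t l \<noteq> factor_at x i l" by blast
  have len: "length u = l" using lj(4) by simp
  have "{t. i \<le> t \<and> t + length u \<le> i + n \<and> factor_at x t (length u) = u} = {i, j}"
    (is "?S = _")
  proof (intro equalityI subsetI)
    fix t assume "t \<in> ?S"
    then have "i \<le> t" "t + l \<le> i + n" "factor_at x t l = factor_at x i l"
      unfolding len unfolding lj(4) by simp_all
    then have "i \<le> t" "t \<le> j" "\<not> (i < t \<and> t < j)" using lj(3) lj(6)[of t] by auto
    then show "t \<in> {i, j}" by auto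
  next
    fix t assume "t \<in> {i, j}"
    then show "t \<in> ?S" unfolding len unfolding lj(4) using lj(2,3,5) by auto
  qed
  then have "occurrences u (factor_at x i n) = 2"
    using lj(2) by (simp add: occurrences_factor_at)
  moreover have "border u (factor_at x i n)"
  proof -
    have "i + n - l = j" "l \<le> n" "u \<noteq> []" using lj(1-3) len by auto
    then show ?thesis
      unfolding border_def prefix_factor_at_iff suffix_factor_at_iff len using lj(4,5) by simp
  qed
  ultimately show ?L by blast
qed

lemma closed_factor_at_iff:
  "closed_word (factor_at x i n) \<longleftrightarrow> n \<le> 1 \<or>
     (\<exists>l j. 1 \<le> l \<and> i < j \<and> j + l = i + n \<and> factor_at x j l = factor_at x i l \<and>
        (\<forall>t. i < t \<and> t < j \<longrightarrow> factor_at x t l \<noteq> factor_at x i l))"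
  unfolding closed_word_def border_twice_iff by auto

text \<open>In a privileged word, the border for a given \<open>m\<close> is the longest word
  of length at most \<open>m\<close> in the chain of privileged borders.\<close>

definition privileged_at :: "(nat \<Rightarrow> 'a) \<Rightarrow> nat \<Rightarrow> nat \<Rightarrow> bool" where
  "privileged_at x i n \<longleftrightarrow> (\<forall>m. 1 \<le> m \<and> m < n \<longrightarrow>
     (\<exists>l j. 1 \<le> l \<and> l \<le> m \<and> j + l = i + n \<and> factor_at x j l = factor_at x i l \<and>
        (\<forall>t. i < t \<and> t + l \<le> i + m \<longrightarrow> factor_at x t l \<noteq> factor_at x i l) \<and>
        (\<forall>t. i + n \<le> t + m \<and> t < j \<longrightarrow> factor_at x t l \<noteq> factor_at x i l)))"

text \<open>For \<open>m\<close> at least the length of the border \<open>u\<close>, the border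
  itself serves: an end window of length \<open>m < n\<close> has no room for both of its
  occurrences. For smaller \<open>m\<close>, the border that \<open>u\<close> provides serves, since
  the end windows lie inside the two copies of \<open>u\<close>.\<close>

lemma privileged_imp_privileged_at: "privileged w \<Longrightarrow> w = factor_at x i n \<Longrightarrow> privileged_at x i n"
proof (induction arbitrary: i n rule: privileged.induct)
  case (short w)
  then show ?case by (auto simp: privileged_at_def)
next
  case (border u w)
  then obtain l j where lj: "1 \<le> l" "i < j" "j + l = i + n" "u = factor_at x i l"
    "factor_at x j l = factor_at x i l"
    "\<And>t. i < t \<Longrightarrow> t < j \<Longrightarrow> factor_at x t l \<noteq> factor_at x i l"
    using border_twice_iff[of u x i n] by blast
  show ?case
    unfolding privileged_at_def
  proof (intro allI impI)
    fix m assume m: "1 \<le> m \<and> m < n"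
    show "\<exists>l j. 1 \<le> l \<and> l \<le> m \<and> j + l = i + n \<and> factor_at x j l = factor_at x i l \<and>
        (\<forall>t. i < t \<and> t + l \<le> i + m \<longrightarrow> factor_at x t l \<noteq> factor_at x i l) \<and>
        (\<forall>t. i + n \<le> t + m \<and> t < j \<longrightarrow> factor_at x t l \<noteq> factor_at x i l)"
    proof (cases "l \<le> m")
      case True
      show ?thesis
        by (rule exI[of _ l], rule exI[of _ j], intro conjI allI impI)
          (use lj m True in auto)
    next
      case False
      with border.IH[OF lj(4)] m obtain l' j' where l': "1 \<le> l'" "l' \<le> m" "j' + l' = i + l"
        "factor_at x j' l' = factor_at x i l'"
        "\<And>t. i < t \<Longrightarrow> t + l' \<le> i + m \<Longrightarrow> factor_at x t l' \<noteq> factor_at x i l'"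
        "\<And>t. i + l \<le> t + m \<Longrightarrow> t < j' \<Longrightarrow> factor_at x t l' \<noteq> factor_at x i l'"
        unfolding privileged_at_def by (metis not_le)
      have shift: "factor_at x (j + d) l' = factor_at x (i + d) l'" if "d + l' \<le> l" for d
        using factor_at_sub[OF lj(5) that] .
      have "i \<le> j'" using l' False by linarith
      show ?thesis
      proof (rule exI[of _ l'], rule exI[of _ "j + (j' - i)"], intro conjI allI impI)
        show "factor_at x (j + (j' - i)) l' = factor_at x i l'"
          using shift[of "j' - i"] l'(3,4) \<open>i \<le> j'\<close> by simp
        fix t assume t: "i + n \<le> t + m \<and> t < j + (j' - i)"
        \<comment> \<open>The last \<open>m\<close> letters lie within the second copy of
          \<open>u\<close>, because \<open>m < l\<close>.\<close>
        then have "j \<le> t" using lj(3) False by linarith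
        have short: "t - j + l' \<le> l" using t l'(3) \<open>i \<le> j'\<close> \<open>j \<le> t\<close> by linarith
        have "factor_at x t l' = factor_at x (i + (t - j)) l'"
          using shift[OF short] \<open>j \<le> t\<close> by simp
        moreover have "factor_at x (i + (t - j)) l' \<noteq> factor_at x i l'"
          using t l'(3) lj(3) \<open>i \<le> j'\<close> \<open>j \<le> t\<close> by (intro l'(6)) linarith+
        ultimately show "factor_at x t l' \<noteq> factor_at x i l'" by simp
      qed (use l' lj \<open>i \<le> j'\<close> in auto)
    qed
  qed
qed

text \<open>The case \<open>m = n - 1\<close> yields a border with no occurrence between the first
  and the final one, hence exactly two. The border inherits the condition: for \<open>m < l\<close>,
  the witnessing suffix of the word lies in the second copy of the border and moves back to the
  first.\<close>

lemma privileged_at_imp_privileged: "privileged_at x i n \<Longrightarrow> privileged (factor_at x i n)"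
proof (induction n rule: less_induct)
  case (less n)
  show ?case
  proof (cases "n \<le> 1")
    case True
    then show ?thesis by (intro privileged.short) simp
  next
    case False
    then have "1 \<le> n - 1 \<and> n - 1 < n" by auto
    from less.prems[unfolded privileged_at_def, rule_format, OF this]
    obtain l j where l: "1 \<le> l" "l \<le> n - 1" "j + l = i + n"
      "factor_at x j l = factor_at x i l"
      "\<And>t. i < t \<Longrightarrow> t + l \<le> i + (n - 1) \<Longrightarrow> factor_at x t l \<noteq> factor_at x i l"
      by blast
    have "i < j" using l False by linarith
    moreover have "factor_at x t l \<noteq> factor_at x i l" if "i < t" "t < j" for t
      using that l(3) False by (intro l(5)) linarith+
    ultimately have twice: "border (factor_at x i l) (factor_at x i n)"
      "occurrences (factor_at x i l) (factor_at x i n) = 2"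
      using border_twice_iff[of "factor_at x i l" x i n] l by blast+
    have "privileged_at x i l"
      unfolding privileged_at_def
    proof (intro allI impI)
      fix m assume m: "1 \<le> m \<and> m < l"
      then have "1 \<le> m \<and> m < n" using l(2) by linarith
      from less.prems[unfolded privileged_at_def, rule_format, OF this]
      obtain l' j' where l': "1 \<le> l'" "l' \<le> m" "j' + l' = i + n"
        "factor_at x j' l' = factor_at x i l'"
        "\<And>t. i < t \<Longrightarrow> t + l' \<le> i + m \<Longrightarrow> factor_at x t l' \<noteq> factor_at x i l'"
        "\<And>t. i + n \<le> t + m \<Longrightarrow> t < j' \<Longrightarrow> factor_at x t l' \<noteq> factor_at x i l'"
        by blast
      have shift: "factor_at x (j + d) l' = factor_at x (i + d) l'" if "d + l' \<le> l" for d
        using factor_at_sub[OF l(4) that] .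
      have "j \<le> j'" using l' l m by linarith
      show "\<exists>k h. 1 \<le> k \<and> k \<le> m \<and> h + k = i + l \<and> factor_at x h k = factor_at x i k \<and>
        (\<forall>t. i < t \<and> t + k \<le> i + m \<longrightarrow> factor_at x t k \<noteq> factor_at x i k) \<and>
        (\<forall>t. i + l \<le> t + m \<and> t < h \<longrightarrow> factor_at x t k \<noteq> factor_at x i k)"
      proof (rule exI[of _ l'], rule exI[of _ "i + (j' - j)"], intro conjI allI impI)
        show "factor_at x (i + (j' - j)) l' = factor_at x i l'"
          using shift[of "j' - j"] l'(3,4) l(3) \<open>j \<le> j'\<close> by simp
        fix t assume t: "i + l \<le> t + m \<and> t < i + (j' - j)"
        then have "i \<le> t" using m by linarith
        have short: "t - i + l' \<le> l" using t l'(3) l(3) \<open>i \<le> t\<close> by linarith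
        have "factor_at x t l' = factor_at x (j + (t - i)) l'"
          using shift[OF short] \<open>i \<le> t\<close> by simp
        moreover have "factor_at x (j + (t - i)) l' \<noteq> factor_at x i l'"
          using t l(3) \<open>i \<le> t\<close> by (intro l'(6)) linarith+
        ultimately show "factor_at x t l' \<noteq> factor_at x i l'" by simp
      qed (use l' l \<open>j \<le> j'\<close> in auto)
    qed
    then have "privileged (factor_at x i l)"
      using less.IH l(2) False by simp
    with twice show ?thesis by (rule privileged.border)
  qed
qed

lemma privileged_factor_at_iff: "privileged (factor_at x i n) \<longleftrightarrow> privileged_at x i n"
  using privileged_imp_privileged_at privileged_at_imp_privileged by blast

section \<open>Rich words\<close>

abbreviation palindromic_factors :: "'a list \<Rightarrow> 'a list set" where
  "palindromic_factors w \<equiv> {p. sublist p w \<and> palindromic p}"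

lemma finite_sublist_Collect: "finite {p. sublist p w \<and> Q p}"
  by (rule finite_subset[of _ "set (sublists w)"]) auto

text \<open>A palindromic suffix shorter than another one is also a prefix of the latter, hence it has
  occurred before: the last letter contributes at most one new palindrome.\<close>

lemma new_palindromic_suffix_unique:
  assumes "suffix p (w @ [c])" "palindromic p" "\<not> sublist p w"
    and "suffix q (w @ [c])" "palindromic q" "\<not> sublist q w"
  shows "p = q"
proof -
  have shorter: "sublist p w"
    if "suffix p (w @ [c])" "palindromic p" "suffix q (w @ [c])" "palindromic q"
      "length p < length q" for p q
  proof -
    have "suffix p q" using that suffix_length_suffix by fastforce
    then have "prefix p q"
      using that(2,4) by (metis palindromic_def suffix_to_prefix)
    from that(3,5) obtain q' where q': "q = q' @ [c]" "suffix q' w"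
      by (cases q rule: rev_cases) auto
    \<comment> \<open>\<open>p\<close> is shorter than \<open>q\<close>, so it remains a prefix when
      the last letter of \<open>q\<close> is removed.\<close>
    then have "prefix p q'" using \<open>prefix p q\<close> that(5) by (auto simp: prefix_snoc)
    then show ?thesis
      using q'(2) by (meson prefix_imp_sublist suffix_imp_sublist sublist_order.order_trans)
  qed
  have "length p = length q"
    using shorter assms by (metis linorder_neqE_nat)
  then show ?thesis
    using assms(1,4) by (metis suffix_length_suffix order_refl suffix_order.antisym)
qed

text \<open>Only a suffix can be a new factor, and by uniqueness at most one new suffix is a
  palindrome.\<close>

lemma card_palindromic_factors_snoc:
  "card (palindromic_factors (w @ [c])) = card (palindromic_factors w) +
     (if \<exists>p. suffix p (w @ [c]) \<and> palindromic p \<and> \<not> sublist p w then 1 else 0)"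
proof (cases "\<exists>p. suffix p (w @ [c]) \<and> palindromic p \<and> \<not> sublist p w")
  case True
  then obtain p where p: "suffix p (w @ [c])" "palindromic p" "\<not> sublist p w" by blast
  have "palindromic_factors (w @ [c]) = insert p (palindromic_factors w)"
  proof (intro equalityI subsetI)
    fix r assume "r \<in> palindromic_factors (w @ [c])"
    then have r: "palindromic r" "suffix r (w @ [c]) \<or> sublist r w"
      by (auto simp: sublist_snoc)
    then show "r \<in> insert p (palindromic_factors w)"
      using new_palindromic_suffix_unique[OF p] by blast
  next
    fix r assume "r \<in> insert p (palindromic_factors w)"
    then show "r \<in> palindromic_factors (w @ [c])"
      using p(1,2) unfolding sublist_snoc by blast
  qed
  then show ?thesis
    using True p by (simp add: finite_sublist_Collect)
next
  case False
  then have "palindromic_factors (w @ [c]) = palindromic_factors w"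
    unfolding sublist_snoc by blast
  with False show ?thesis by simp
qed

lemma card_palindromic_factors_Nil: "card (palindromic_factors []) = 1"
proof -
  have "palindromic_factors [] = {[]}" by (auto simp: palindromic_def)
  then show ?thesis by (metis card_1_singleton_iff One_nat_def)
qed

lemma card_palindromic_factors_le: "card (palindromic_factors w) \<le> length w + 1"
proof (induction w rule: rev_induct)
  case Nil
  show ?case using card_palindromic_factors_Nil[where 'a = 'a] by simp
next
  case (snoc c w)
  then show ?case unfolding card_palindromic_factors_snoc by simp
qed

lemma rich_Nil: "rich []"
  using card_palindromic_factors_Nil unfolding rich_def by simp

text \<open>The last letter adds at most 1 to a count that is at most \<open>length w + 1\<close>,
  so the maximum is reached only if \<open>w\<close> reaches it and a new palindrome
  appears.\<close>

lemma rich_snoc_iff: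
  "rich (w @ [c]) \<longleftrightarrow> rich w \<and> (\<exists>p. suffix p (w @ [c]) \<and> palindromic p \<and> \<not> sublist p w)"
  using card_palindromic_factors_le[of w]
  unfolding rich_def card_palindromic_factors_snoc by simp

text \<open>Letters are appended one at a time, and \<open>s\<close> is where the new palindromic
  suffix starts. The empty suffix is excluded by the last condition, as it also occurs at
  \<open>t = i\<close>.\<close>

lemma rich_factor_at_iff:
  "rich (factor_at x i n) \<longleftrightarrow>
     (\<forall>j<n. \<exists>l s. i \<le> s \<and> s + l = i + j + 1 \<and> palindromic (factor_at x s l) \<and>
        (\<forall>t. i \<le> t \<and> t < s \<longrightarrow> factor_at x t l \<noteq> factor_at x s l))"
proof (induction n)
  case 0
  then show ?case by (simp add: rich_Nil)
next
  case (Suc n)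
  have "(\<exists>p. suffix p (factor_at x i (Suc n)) \<and> palindromic p \<and> \<not> sublist p (factor_at x i n)) \<longleftrightarrow>
     (\<exists>l s. i \<le> s \<and> s + l = i + n + 1 \<and> palindromic (factor_at x s l) \<and>
        (\<forall>t. i \<le> t \<and> t < s \<longrightarrow> factor_at x t l \<noteq> factor_at x s l))" (is "?L \<longleftrightarrow> ?R")
  proof
    assume ?L
    then obtain p where p: "suffix p (factor_at x i (Suc n))" "palindromic p"
      "\<not> sublist p (factor_at x i n)" by blast
    define l where "l = length p"
    define s where "s = i + Suc n - l"
    have ps: "l \<le> Suc n" "p = factor_at x s l"
      using p(1) by (auto simp: suffix_factor_at_iff l_def s_def)
    then have "s + l = i + n + 1" "i \<le> s" by (auto simp: s_def)
    moreover have "factor_at x t l \<noteq> factor_at x s l" if "i \<le> t" "t < s" for t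
    proof
      assume "factor_at x t l = factor_at x s l"
      \<comment> \<open>An occurrence that starts before \<open>s\<close> ends before the last
        letter.\<close>
      moreover have "t + l \<le> i + n" using that \<open>s + l = i + n + 1\<close> by linarith
      ultimately show False
        using p(3) that ps(2) unfolding sublist_factor_at_iff by (metis length_factor_at)
    qed
    ultimately show ?R using ps(2) p(2) by blast
  next
    assume ?R
    then obtain l s where ls: "i \<le> s" "s + l = i + n + 1" "palindromic (factor_at x s l)"
      "\<And>t. i \<le> t \<Longrightarrow> t < s \<Longrightarrow> factor_at x t l \<noteq> factor_at x s l" by blast
    have "i + Suc n - l = s" "l \<le> Suc n" using ls by linarith+
    then have "suffix (factor_at x s l) (factor_at x i (Suc n))"
      by (auto simp: suffix_factor_at_iff)
    moreover have "\<not> sublist (factor_at x s l) (factor_at x i n)"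
    proof
      assume "sublist (factor_at x s l) (factor_at x i n)"
      then obtain t where "i \<le> t" "t + l \<le> i + n" "factor_at x s l = factor_at x t l"
        by (auto simp: sublist_factor_at_iff)
      then show False using ls(2) ls(4)[of t] by simp
    qed
    ultimately show ?L using ls(3) by blast
  qed
  then show ?case
    using Suc.IH by (auto simp: factor_at_Suc rich_snoc_iff less_Suc_eq)
qed

section \<open>Balanced words\<close>

lemma count_list_factor_at_Suc:
  "count_list (factor_at x p (Suc n)) a = count_list (factor_at x p n) a + of_bool (x (p + n) = a)"
  by (simp add: factor_at_Suc)

lemma count_list_factor_at_cong:
  "(\<And>t. t < l \<Longrightarrow> x (p + t) = a \<longleftrightarrow> x (q + t) = a) \<Longrightarrow>
     count_list (factor_at x p l) a = count_list (factor_at x q l) a"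
  by (induction l) (simp_all add: count_list_factor_at_Suc)

lemma count_list_factor_at_enclosed:
  "count_list (factor_at x p (l + 2)) a =
     of_bool (x p = a) + count_list (factor_at x (p + 1) l) a + of_bool (x (p + l + 1) = a)"
proof -
  have "factor_at x p (1 + l) = factor_at x p 1 @ factor_at x (p + 1) l"
    by (rule factor_at_add)
  moreover have "factor_at x p 1 = [x p]" by (simp add: factor_at_def)
  moreover have "factor_at x p (l + 2) = factor_at x p (1 + l) @ [x (p + l + 1)]"
    using factor_at_Suc[of x p "1 + l"] by (simp add: add.commute add.left_commute)
  ultimately show ?thesis by simp
qed

text \<open>The difference of the counts in two windows changes by at most 1 per step; the pattern sits
  between the last time it is 0 and the first time it is 2.\<close>

lemma unbalanced_pattern:
  assumes "count_list (factor_at x q n) a + 2 \<le> count_list (factor_at x p n) a"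
  shows "\<exists>s l. s + l + 2 \<le> n \<and> x (p + s) = a \<and> x (q + s) \<noteq> a \<and>
    x (p + s + l + 1) = a \<and> x (q + s + l + 1) \<noteq> a \<and>
    (\<forall>t<l. x (p + s + 1 + t) = a \<longleftrightarrow> x (q + s + 1 + t) = a)"
proof -
  define D where
    "D t = int (count_list (factor_at x p t) a) - int (count_list (factor_at x q t) a)" for t
  have D0: "D 0 = 0" by (simp add: D_def)
  have DSuc: "D (Suc t) = D t + of_bool (x (p + t) = a) - of_bool (x (q + t) = a)" for t
    by (simp add: D_def count_list_factor_at_Suc)
  define T where "T = (LEAST t. 2 \<le> D t)"
  have "2 \<le> D n" using assms by (simp add: D_def)
  then have T: "2 \<le> D T" "T \<le> n" unfolding T_def by (auto intro: LeastI Least_le)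
  have before: "D t \<le> 1" if "t < T" for t
    using not_less_Least[of t "\<lambda>t. 2 \<le> D t"] that by (simp add: T_def)
  have "T \<noteq> 0" using T(1) D0 by (intro notI) simp
  then obtain e where e: "T = Suc e" using not0_implies_Suc by blast
  \<comment> \<open>\<open>D\<close> first reaches 2 at \<open>T\<close> and rises by at most 1 per
    step, so the step into \<open>T\<close> comes from 1 and reads \<open>a\<close> only in the
    window at \<open>p\<close>.\<close>
  have De: "D e = 1" "x (p + e) = a" "x (q + e) \<noteq> a"
    using before[of e] T(1) DSuc[of e] e by (auto split: if_splits simp: of_bool_def)
  \<comment> \<open>The last time before \<open>T\<close> at which \<open>D\<close> is not positive;
    it exists because \<open>D 0 = 0\<close>.\<close>
  define s where "s = (GREATEST t. t < T \<and> D t \<le> 0)"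
  have bound: "\<And>t. t < T \<and> D t \<le> 0 \<Longrightarrow> t \<le> T" by simp
  have s: "s < T" "D s \<le> 0"
    using GreatestI_nat[of "\<lambda>t. t < T \<and> D t \<le> 0" 0 T, OF _ bound] D0 e unfolding s_def by auto
  have after: "D t = 1" if "s < t" "t < T" for t
  proof -
    have "\<not> D t \<le> 0"
      using Greatest_le_nat[of "\<lambda>t. t < T \<and> D t \<le> 0" t T, OF _ bound] that unfolding s_def by auto
    with before[OF that(2)] show ?thesis by linarith
  qed
  have "s \<noteq> e" using s(2) De(1) by (intro notI) simp
  then have "s < e" using s(1) e by simp
  then have "D (Suc s) = 1" using after[of "Suc s"] e by simp
  then have Ds: "x (p + s) = a" "x (q + s) \<noteq> a"
    using DSuc[of s] s(2) by (auto split: if_splits simp: of_bool_def)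
  \<comment> \<open>The length of the part strictly between the disagreements at \<open>s\<close>
    and \<open>e\<close>, on which \<open>D\<close> stays at 1.\<close>
  define l where "l = e - Suc s"
  have l: "s + l + 1 = e" using \<open>s < e\<close> by (simp add: l_def)
  have "x (p + s + 1 + t) = a \<longleftrightarrow> x (q + s + 1 + t) = a" if "t < l" for t
  proof -
    have "D (Suc (s + 1 + t)) = 1" "D (s + 1 + t) = 1" using that l e by (auto intro!: after)
    then show ?thesis
      using DSuc[of "s + 1 + t"] by (auto split: if_splits simp: of_bool_def add.assoc)
  qed
  moreover have "s + l + 2 \<le> n" using l e T(2) by simp
  moreover have "x (p + s + l + 1) = a" "x (q + s + l + 1) \<noteq> a"
    using De(2,3) unfolding l[symmetric] by (simp_all add: add.assoc)
  ultimately show ?thesis using Ds by blast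
qed

text \<open>Enclosing two blocks that agree on \<open>a\<close> by \<open>a\<close> on both sides in
  one case and by other letters in the other makes the counts differ by 2. Conversely,
  \<open>unbalanced_pattern\<close> finds such windows inside any two factors that violate
  balance.\<close>

lemma balanced_factor_at_iff:
  "balanced (factor_at x i n) \<longleftrightarrow>
     (\<forall>a p q l. i \<le> p \<and> p + l + 1 < i + n \<and> i \<le> q \<and> q + l + 1 < i + n \<and>
        x p = a \<and> \<not> x q = a \<and> x (p + l + 1) = a \<and> \<not> x (q + l + 1) = a \<longrightarrow>
        (\<exists>t. t < l \<and> \<not> (x (p + 1 + t) = a \<longleftrightarrow> x (q + 1 + t) = a)))" (is "?L \<longleftrightarrow> ?R")
proof
  assume L: ?L
  show ?R
  proof (intro allI impI, rule ccontr)
    fix a p q l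
    assume pq: "i \<le> p \<and> p + l + 1 < i + n \<and> i \<le> q \<and> q + l + 1 < i + n \<and>
        x p = a \<and> \<not> x q = a \<and> x (p + l + 1) = a \<and> \<not> x (q + l + 1) = a"
      and "\<not> (\<exists>t. t < l \<and> \<not> (x (p + 1 + t) = a \<longleftrightarrow> x (q + 1 + t) = a))"
    then have mid: "count_list (factor_at x (p + 1) l) a = count_list (factor_at x (q + 1) l) a"
      by (intro count_list_factor_at_cong) blast
    have "sublist (factor_at x p (l + 2)) (factor_at x i n)"
      unfolding sublist_factor_at_iff length_factor_at using pq by (intro exI[of _ p]) auto
    moreover have "sublist (factor_at x q (l + 2)) (factor_at x i n)"
      unfolding sublist_factor_at_iff length_factor_at using pq by (intro exI[of _ q]) auto
    ultimately have "\<bar>int (count_list (factor_at x p (l + 2)) a) -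
        int (count_list (factor_at x q (l + 2)) a)\<bar> \<le> 1"
      using L unfolding balanced_def length_factor_at by (metis length_factor_at)
    then show False
      using pq mid unfolding count_list_factor_at_enclosed by simp
  qed
next
  assume R: ?R
  \<comment> \<open>A one-sided bound suffices, since \<open>y\<close> and \<open>z\<close> can be
    exchanged.\<close>
  have le: "int (count_list y a) - int (count_list z a) \<le> 1"
    if yz: "sublist y (factor_at x i n)" "sublist z (factor_at x i n)" "length y = length z" for y z a
  proof (rule ccontr)
    assume unbalanced: "\<not> int (count_list y a) - int (count_list z a) \<le> 1"
    define m where "m = length y"
    obtain p where p: "i \<le> p" "p + m \<le> i + n" "y = factor_at x p m"
      using yz(1) unfolding sublist_factor_at_iff m_def by blast
    obtain q where q: "i \<le> q" "q + m \<le> i + n" "z = factor_at x q m"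
      using yz(2) unfolding sublist_factor_at_iff m_def yz(3) by blast
    have "count_list (factor_at x q m) a + 2 \<le> count_list (factor_at x p m) a"
      using unbalanced p(3) q(3) by simp
    then obtain s l where sl: "s + l + 2 \<le> m" "x (p + s) = a" "\<not> x (q + s) = a"
      "x (p + s + l + 1) = a" "\<not> x (q + s + l + 1) = a"
      "\<forall>t<l. x (p + s + 1 + t) = a \<longleftrightarrow> x (q + s + 1 + t) = a"
      using unbalanced_pattern[of x q m a p] by blast
    have "i \<le> p + s" "p + s + l + 1 < i + n" "i \<le> q + s" "q + s + l + 1 < i + n"
      using p(1,2) q(1,2) sl(1) by linarith+
    with R[rule_format, of "p + s" l "q + s" a] sl(2-6) show False by blast
  qed
  show ?L
    unfolding balanced_def
  proof (intro allI impI, elim conjE)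
    fix y z a
    assume "sublist y (factor_at x i n)" "sublist z (factor_at x i n)" "length y = length z"
    then show "\<bar>int (count_list y a) - int (count_list z a)\<bar> \<le> 1"
      using le[of y z a] le[of z y a] by (simp add: abs_le_iff)
  qed
qed

section \<open>Trapezoidal words\<close>

definition right_special :: "'a list \<Rightarrow> 'a list \<Rightarrow> bool" where
  "right_special w u \<longleftrightarrow> (\<exists>a b. a \<noteq> b \<and> sublist (u @ [a]) w \<and> sublist (u @ [b]) w)"

abbreviation factors :: "'a list \<Rightarrow> nat \<Rightarrow> 'a list set" where
  "factors w m \<equiv> {u. sublist u w \<and> length u = m}"

abbreviation right_specials :: "'a list \<Rightarrow> nat \<Rightarrow> 'a list set" where
  "right_specials w m \<equiv> {u. right_special w u \<and> length u = m}"

lemma sublist_appendD: "sublist (u @ v) w \<Longrightarrow> sublist u w" "sublist (u @ v) w \<Longrightarrow> sublist v w"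
  by (meson sublist_append_leftI sublist_append_rightI sublist_order.order_trans)+

lemma right_special_suffix: "right_special w (v @ u) \<Longrightarrow> right_special w u"
  unfolding right_special_def append_assoc using sublist_appendD(2) by blast

lemma right_specials_subset: "right_specials w m \<subseteq> factors w m"
  unfolding right_special_def using sublist_appendD(1) by blast

lemma finite_right_specials: "finite (right_specials w m)"
  by (rule finite_subset[OF right_specials_subset finite_sublist_Collect])

text \<open>The choices below are arbitrary for words without a suitable extension.\<close>

definition ext :: "'a list \<Rightarrow> 'a list \<Rightarrow> 'a" where
  "ext w u = (SOME a. sublist (u @ [a]) w)"

definition ext' :: "'a list \<Rightarrow> 'a list \<Rightarrow> 'a" where
  "ext' w u = (SOME a. a \<noteq> ext w u \<and> sublist (u @ [a]) w)"

lemma ext: "sublist (u @ [a]) w \<Longrightarrow> sublist (u @ [ext w u]) w"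
  unfolding ext_def by (rule someI)

lemma ext':
  assumes "right_special w u"
  shows "ext' w u \<noteq> ext w u" "sublist (u @ [ext' w u]) w"
proof -
  from assms have "\<exists>a. a \<noteq> ext w u \<and> sublist (u @ [a]) w"
    unfolding right_special_def by metis
  then have "ext' w u \<noteq> ext w u \<and> sublist (u @ [ext' w u]) w"
    unfolding ext'_def by (rule someI_ex)
  then show "ext' w u \<noteq> ext w u" "sublist (u @ [ext' w u]) w" by auto
qed

text \<open>Two different letters following \<open>u\<close> already exhaust the at most two letters
  of \<open>w\<close>.\<close>

lemma right_special_extends:
  assumes "card (set w) \<le> 2" "right_special w u" "e \<in> set w"
  shows "sublist (u @ [e]) w"
proof -
  obtain a b where ab: "a \<noteq> b" "sublist (u @ [a]) w" "sublist (u @ [b]) w"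
    using assms(2) unfolding right_special_def by blast
  then have "{a, b} \<subseteq> set w" by (auto dest!: set_mono_sublist)
  then have "set w = {a, b}"
    using assms(1) ab(1) by (metis List.finite_set card_2_iff card_seteq)
  then show ?thesis using assms(3) ab by auto
qed

text \<open>Extending each factor by \<open>ext\<close>, and each right special one also by
  \<open>ext'\<close>, gives distinct longer factors. The premise rules out a factor that occurs
  only at the end of \<open>w\<close>.\<close>

lemma card_factors_Suc_ge:
  assumes "\<And>u. u \<in> factors w m \<Longrightarrow> \<exists>a. sublist (u @ [a]) w"
  shows "card (factors w m) + card (right_specials w m) \<le> card (factors w (Suc m))"
proof -
  let ?A = "(\<lambda>u. u @ [ext w u]) ` factors w m"
  let ?B = "(\<lambda>u. u @ [ext' w u]) ` right_specials w m"
  have "?A \<union> ?B \<subseteq> factors w (Suc m)"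
  proof (intro Un_least image_subsetI)
    fix u assume "u \<in> factors w m"
    with assms[of u] show "u @ [ext w u] \<in> factors w (Suc m)" using ext by auto
  next
    fix u assume "u \<in> right_specials w m"
    then show "u @ [ext' w u] \<in> factors w (Suc m)" using ext'(2) by auto
  qed
  then have "card (?A \<union> ?B) \<le> card (factors w (Suc m))"
    by (rule card_mono[OF finite_sublist_Collect])
  moreover have "?A \<inter> ?B = {}" using ext'(1) by force
  then have "card (?A \<union> ?B) = card ?A + card ?B"
    by (intro card_Un_disjoint finite_imageI finite_sublist_Collect finite_right_specials)
  moreover have "card ?A = card (factors w m)" by (intro card_image inj_onI) simp
  moreover have "card ?B = card (right_specials w m)" by (intro card_image inj_onI) simp
  ultimately show ?thesis by simp
qed

text \<open>Over at most two letters, \<open>ext\<close> and \<open>ext'\<close> are the only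
  possible extensions, and the second arises only for right special factors.\<close>

lemma card_factors_Suc_le:
  assumes "card (set w) \<le> 2"
  shows "card (factors w (Suc m)) \<le> card (factors w m) + card (right_specials w m)"
proof -
  let ?A = "(\<lambda>u. u @ [ext w u]) ` factors w m"
  let ?B = "(\<lambda>u. u @ [ext' w u]) ` right_specials w m"
  have "factors w (Suc m) \<subseteq> ?A \<union> ?B"
  proof
    fix v assume v: "v \<in> factors w (Suc m)"
    then obtain u a where ua: "v = u @ [a]" "length u = m"
      by (cases v rule: rev_cases) auto
    then have sub: "sublist (u @ [a]) w" using v by simp
    show "v \<in> ?A \<union> ?B"
    proof (cases "a = ext w u")
      case True
      then show ?thesis using ua sublist_appendD(1)[OF sub] by blast
    next
      case False
      then have rs: "right_special w u" using sub ext[OF sub] unfolding right_special_def by blast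
      have letter: "b \<in> set w" if "sublist (u @ [b]) w" for b
        using set_mono_sublist[OF that] by simp
      have "a = ext' w u"
      proof (rule ccontr)
        assume "a \<noteq> ext' w u"
        then have "card {a, ext w u, ext' w u} = 3" using False ext'(1)[OF rs] by auto
        moreover have "card {a, ext w u, ext' w u} \<le> card (set w)"
          using letter sub ext[OF sub] ext'(2)[OF rs] by (intro card_mono) auto
        ultimately show False using assms by simp
      qed
      then show ?thesis using ua rs by blast
    qed
  qed
  then have "card (factors w (Suc m)) \<le> card (?A \<union> ?B)"
    by (intro card_mono finite_UnI finite_imageI finite_sublist_Collect finite_right_specials)
  also have "\<dots> \<le> card ?A + card ?B" by (rule card_Un_le)
  also have "\<dots> \<le> card (factors w m) + card (right_specials w m)"
    by (intro add_mono card_image_le finite_sublist_Collect finite_right_specials)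
  finally show ?thesis .
qed

lemma card_factors_0: "card (factors w 0) = 1"
proof -
  have "factors w 0 = {[]}" by auto
  then show ?thesis by simp
qed

lemma card_factors_1: "card (factors w 1) = card (set w)"
proof -
  have "factors w 1 = (\<lambda>a. [a]) ` set w"
  proof (intro equalityI subsetI)
    fix u assume "u \<in> factors w 1"
    then show "u \<in> (\<lambda>a. [a]) ` set w" by (auto simp: length_Suc_conv dest: set_mono_sublist)
  next
    fix u assume "u \<in> (\<lambda>a. [a]) ` set w"
    then obtain a where "u = [a]" "a \<in> set w" by blast
    moreover then obtain ys zs where "w = ys @ a # zs" by (meson split_list)
    ultimately have "w = ys @ u @ zs" "length u = 1" by simp_all
    then show "u \<in> factors w 1" by simp
  qed
  moreover have "card ((\<lambda>a. [a]) ` set w) = card (set w)" by (intro card_image inj_onI) simp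
  ultimately show ?thesis by simp
qed

text \<open>Two occurrences of \<open>s @ [c]\<close>, the later of which is the last occurrence of \<open>s\<close>
  that is followed by a letter: to the right of them no window of the length of \<open>s\<close> branches,
  so the text from the later occurrence to the end is repeated after the earlier one.\<close>

lemma suffix_repeated:
  assumes unique: "\<And>v. right_special (factor_at x 0 n) v \<Longrightarrow> length v = m \<Longrightarrow> v = factor_at x p m"
    and "q < p" "p + m < n"
    and eq: "factor_at x q (Suc m) = factor_at x p (Suc m)"
    and last: "\<And>t. p < t \<Longrightarrow> t + m < n \<Longrightarrow> factor_at x t m \<noteq> factor_at x p m"
  shows "factor_at x q (n - p) = factor_at x p (n - p)"
proof -
  have "factor_at x q k = factor_at x p k" if "Suc m \<le> k" "p + k \<le> n" for k
    using that
  proof (induction k rule: dec_induct)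
    case base
    show ?case by (rule eq)
  next
    case (step k)
    then have IH: "factor_at x q k = factor_at x p k" and k: "p + k < n" "m < k" by auto
    have "factor_at x (q + (k - m)) m = factor_at x (p + (k - m)) m"
      using factor_at_sub[OF IH, of "k - m" m] k by simp
    moreover have "sublist (factor_at x (r + (k - m)) m @ [x (r + k)]) (factor_at x 0 n)"
      if "r \<le> p" for r
    proof -
      have "factor_at x (r + (k - m)) m @ [x (r + k)] = factor_at x (r + (k - m)) (Suc m)"
        using k by (simp add: factor_at_Suc)
      then show ?thesis
        unfolding sublist_factor_at_iff using that k by (intro exI[of _ "r + (k - m)"]) simp
    qed
    from this[of p] this[of q] have
      "sublist (factor_at x (p + (k - m)) m @ [x (p + k)]) (factor_at x 0 n)"
      "sublist (factor_at x (q + (k - m)) m @ [x (q + k)]) (factor_at x 0 n)"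
      using \<open>q < p\<close> by simp_all
    \<comment> \<open>By uniqueness a right special window would equal the one at \<open>p\<close>,
      but this window starts after \<open>p\<close> and is still followed by a letter.\<close>
    moreover have "\<not> right_special (factor_at x 0 n) (factor_at x (p + (k - m)) m)"
      using unique[of "factor_at x (p + (k - m)) m"] last[of "p + (k - m)"] k by auto
    ultimately have "x (q + k) = x (p + k)"
      unfolding right_special_def by metis
    with IH show ?case by (simp add: factor_at_Suc)
  qed
  from this[of "n - p"] show ?thesis using assms(3) by simp
qed

text \<open>Over two letters, each letter follows both \<open>u = c # s\<close> and \<open>v = d # s\<close>. So the last occurrence
  of \<open>s\<close> that is followed by a letter has an earlier twin with the same next letter; hence the suffix
  of length \<open>m + 1\<close> is repeated.\<close>

lemma two_right_specials_extend:
  assumes binary: "card (set w) \<le> 2"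
    and unique: "\<And>u v. right_special w u \<Longrightarrow> right_special w v \<Longrightarrow>
      length u = m \<Longrightarrow> length v = m \<Longrightarrow> u = v"
    and special: "right_special w u" "right_special w v" "u \<noteq> v" "length u = Suc m" "length v = Suc m"
    and f: "sublist f w" "length f \<le> Suc m"
  shows "\<exists>a. sublist (f @ [a]) w"
proof -
  \<comment> \<open>The word is read as the start of a sequence so that the results on windows
    apply; all windows used stay below \<open>n\<close>.\<close>
  define x where "x = nth w"
  define n where "n = length w"
  have w: "w = factor_at x 0 n"
    by (simp add: factor_at_def x_def n_def map_nth)
  obtain c s where u: "u = c # s" "length s = m" using special(4) by (cases u) auto
  obtain d s' where v: "v = d # s'" "length s' = m" using special(5) by (cases v) auto
  have rs: "right_special w s" "right_special w s'"
    using special(1,2) right_special_suffix[of w "[c]" s] right_special_suffix[of w "[d]" s']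
    unfolding u(1) v(1) by simp_all
  \<comment> \<open>Both tails are right special of length \<open>m\<close>, where uniqueness holds,
    so \<open>u\<close> and \<open>v\<close> can differ only in their first letters.\<close>
  then have "s' = s" using unique u(2) v(2) by blast
  then have "c \<noteq> d" using special(3) u v by simp
  define P where "P t \<longleftrightarrow> t + m < n \<and> factor_at x t m = s" for t
  have P_occ: "\<exists>t. P (Suc t) \<and> x t = e \<and> x (Suc t + m) = a" if "sublist (e # s @ [a]) w" for e a
  proof -
    from that obtain t where t: "t + (m + 2) \<le> n" "e # s @ [a] = factor_at x t (m + 2)"
      unfolding w sublist_factor_at_iff using u(2) by auto
    have "factor_at x t (m + 2) = factor_at x t 1 @ factor_at x (t + 1) m @ factor_at x (t + 1 + m) 1"
      using factor_at_add[of x t 1 "m + 1"] factor_at_add[of x "t + 1" m 1] by (simp add: add.commute)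
    then have "e # s @ [a] = x t # factor_at x (Suc t) m @ [x (Suc t + m)]"
      using t(2) by (simp add: factor_at_def)
    with t(1) have "P (Suc t) \<and> x t = e \<and> x (Suc t + m) = a" by (simp add: P_def)
    then show ?thesis ..
  qed
  obtain a where a: "sublist (c # s @ [a]) w"
    using special(1) unfolding right_special_def u(1) by auto
  define p where "p = (GREATEST t. P t)"
  have bound: "t \<le> n" if "P t" for t using that by (simp add: P_def)
  have p: "P p" unfolding p_def using P_occ[OF a] bound by (metis GreatestI_nat)
  have pmax: "t \<le> p" if "P t" for t unfolding p_def using that bound by (metis Greatest_le_nat)
  have "\<exists>q. q < p \<and> P q \<and> x (q + m) = x (p + m)"
  proof -
    define a' where "a' = x (p + m)"
    have "a' \<in> set w" using p by (simp add: a'_def P_def x_def n_def)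
    then have "sublist (c # s @ [a']) w" "sublist (d # s @ [a']) w"
      using right_special_extends[OF binary special(1)] right_special_extends[OF binary special(2)]
      unfolding u(1) v(1) \<open>s' = s\<close> by simp_all
    then obtain t1 t2 where t: "P (Suc t1)" "x t1 = c" "x (Suc t1 + m) = a'"
      "P (Suc t2)" "x t2 = d" "x (Suc t2 + m) = a'"
      using P_occ by blast
    \<comment> \<open>Different preceding letters give different occurrences of \<open>s\<close>, so
      at least one of them comes before the last one.\<close>
    have "t1 \<noteq> t2" using t(2,5) \<open>c \<noteq> d\<close> by blast
    then have "Suc t1 < p \<or> Suc t2 < p" using pmax[OF t(1)] pmax[OF t(4)] by linarith
    then show ?thesis using t unfolding a'_def by blast
  qed
  then obtain q where q: "q < p" "P q" "x (q + m) = x (p + m)" by blast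
  have rep: "factor_at x q (n - p) = factor_at x p (n - p)"
  proof (rule suffix_repeated[where m = m])
    show "v = factor_at x p m" if "right_special (factor_at x 0 n) v" "length v = m" for v
      using that unique rs(1) u(2) p unfolding w[symmetric] P_def by blast
    show "factor_at x q (Suc m) = factor_at x p (Suc m)"
      using p q(2,3) by (simp add: factor_at_Suc P_def)
    show "factor_at x t m \<noteq> factor_at x p m" if "p < t" "t + m < n" for t
      using pmax[of t] that p unfolding P_def by auto
  qed (use q p in \<open>auto simp: P_def\<close>)
  define l where "l = length f"
  obtain j where j: "j + l \<le> n" "f = factor_at x j l"
    using f(1) unfolding w sublist_factor_at_iff l_def by auto
  have "\<exists>j. j + l < n \<and> f = factor_at x j l"
  proof (cases "j + l < n")
    case True
    with j show ?thesis by blast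
  next
    case False
    then have jl: "j + l = n" using j(1) by simp
    \<comment> \<open>Since \<open>p + m < n\<close>, the repeated suffix has at least
      \<open>m + 1\<close> letters and contains the final occurrence of \<open>f\<close>.\<close>
    moreover have "p \<le> j" using jl f(2) p by (simp add: l_def P_def)
    ultimately have "factor_at x (q + (j - p)) l = factor_at x (p + (j - p)) l"
      by (intro factor_at_sub[OF rep]) simp
    then show ?thesis using \<open>p \<le> j\<close> jl q(1) j(2) by (intro exI[of _ "q + (j - p)"]) simp
  qed
  then obtain k where k: "k + l < n" "f = factor_at x k l" by blast
  then have "f @ [x (k + l)] = factor_at x k (Suc l)" by (simp add: factor_at_Suc)
  moreover have "sublist (factor_at x k (Suc l)) w"
    unfolding w sublist_factor_at_iff using k(1) by (intro exI[of _ k]) simp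
  ultimately show ?thesis by metis
qed

text \<open>If uniqueness first fails at length \<open>m\<close>, all factors of length at most
  \<open>m\<close> extend to the right, so there are at least \<open>m + 1\<close> factors of length
  \<open>m\<close> and \<open>m + 3\<close> of length \<open>m + 1\<close>. Conversely, over two
  letters with at most one right special factor per length, the count starts at 1 and grows by at
  most 1.\<close>

lemma trapezoidal_iff:
  "trapezoidal w \<longleftrightarrow> card (set w) \<le> 2 \<and> (\<forall>m. \<forall>u\<in>right_specials w m. \<forall>v\<in>right_specials w m. u = v)"
  (is "?L \<longleftrightarrow> ?C \<and> (\<forall>m. ?U m)")
proof
  assume L: ?L
  have C: ?C using L card_factors_1[of w] unfolding trapezoidal_def by (metis one_add_one)
  have "?U m" for m
  proof (induction m rule: less_induct)
    case (less m)
    show ?case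
    proof (rule ccontr)
      assume "\<not> ?U m"
      then obtain u v where uv: "right_special w u" "right_special w v" "u \<noteq> v"
        "length u = m" "length v = m" by blast
      have "m \<noteq> 0" using uv(3-5) by auto
      then obtain k where k: "m = Suc k" using not0_implies_Suc by blast
      have extends: "\<exists>a. sublist (f @ [a]) w" if "sublist f w" "length f \<le> m" for f
      proof (rule two_right_specials_extend[OF C _ uv(1-3)])
        show "u' = v'" if "right_special w u'" "right_special w v'" "length u' = k" "length v' = k"
          for u' v'
          using less.IH[of k] that k by blast
      qed (use uv(4,5) that k in simp_all)
      have "j + 1 \<le> card (factors w j)" if "j \<le> m" for j
        using that
      proof (induction j)
        case 0
        show ?case using card_factors_0[of w] by simp
      next
        case (Suc j)
        have "card (factors w j) + card (right_specials w j) \<le> card (factors w (Suc j))"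
          using extends Suc.prems by (intro card_factors_Suc_ge) auto
        moreover have "right_specials w j \<noteq> {}"
        proof -
          \<comment> \<open>The suffixes of \<open>u\<close> supply a right special factor of every
            length up to \<open>m\<close>.\<close>
          have "right_special w (drop (m - j) u)"
            by (rule right_special_suffix[of w "take (m - j) u"]) (simp add: uv(1))
          moreover have "length (drop (m - j) u) = j" using uv(4) Suc.prems by simp
          ultimately show ?thesis by blast
        qed
        then have "0 < card (right_specials w j)"
          using finite_right_specials[of w j] by (simp add: card_gt_0_iff)
        ultimately show ?case using Suc by simp
      qed
      from this[of m] have "m + 1 \<le> card (factors w m)" by simp
      moreover have "card (factors w m) + card (right_specials w m) \<le> card (factors w (Suc m))"
        using extends by (intro card_factors_Suc_ge) auto
      moreover have "card {u, v} \<le> card (right_specials w m)"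
        using uv by (intro card_mono finite_right_specials) auto
      then have "2 \<le> card (right_specials w m)" using uv(3) by simp
      moreover have "card (factors w (Suc m)) \<le> Suc m + 1"
        using L unfolding trapezoidal_def by blast
      ultimately show False by linarith
    qed
  qed
  with C show "?C \<and> (\<forall>m. ?U m)" by blast
next
  assume R: "?C \<and> (\<forall>m. ?U m)"
  have "card (factors w m) \<le> m + 1" for m
  proof (induction m)
    case 0
    show ?case using card_factors_0[of w] by simp
  next
    case (Suc m)
    have "card (right_specials w m) \<le> 1"
      using R finite_right_specials[of w m] by (subst card_le_Suc0_iff_eq[folded One_nat_def]) auto
    with Suc card_factors_Suc_le[of w m] R show ?case by linarith
  qed
  then show ?L unfolding trapezoidal_def by blast
qed

section \<open>Trapezoidal words in terms of positions\<close>

lemma sublist_snoc_factor_at_iff: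
  "sublist (u @ [a]) (factor_at x i n) \<longleftrightarrow> (\<exists>j. i \<le> j \<and> j + length u < i + n \<and>
     factor_at x j (length u) = u \<and> x (j + length u) = a)"
  unfolding sublist_factor_at_iff by (auto simp: factor_at_Suc Suc_le_eq)

lemma right_special_factor_at_iff:
  "right_special (factor_at x i n) u \<longleftrightarrow> (\<exists>p q. i \<le> p \<and> p + length u < i + n \<and>
     i \<le> q \<and> q + length u < i + n \<and> factor_at x p (length u) = u \<and> factor_at x q (length u) = u \<and>
     x (p + length u) \<noteq> x (q + length u))"
  unfolding right_special_def sublist_snoc_factor_at_iff by blast

text \<open>Replaces a cardinality by a condition on three elements, which the logic can
  express.\<close>

lemma card_le_2_iff:
  assumes "finite A"
  shows "card A \<le> 2 \<longleftrightarrow> (\<forall>a\<in>A. \<forall>b\<in>A. \<forall>c\<in>A. a = b \<or> a = c \<or> b = c)"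
proof
  assume card: "card A \<le> 2"
  show "\<forall>a\<in>A. \<forall>b\<in>A. \<forall>c\<in>A. a = b \<or> a = c \<or> b = c"
  proof (intro ballI, rule ccontr)
    fix a b c assume abc: "a \<in> A" "b \<in> A" "c \<in> A" "\<not> (a = b \<or> a = c \<or> b = c)"
    then have "card {a, b, c} \<le> card A" by (intro card_mono assms) auto
    with abc(4) card show False by simp
  qed
next
  assume R: "\<forall>a\<in>A. \<forall>b\<in>A. \<forall>c\<in>A. a = b \<or> a = c \<or> b = c"
  show "card A \<le> 2"
  proof (rule ccontr)
    assume "\<not> card A \<le> 2"
    then have "3 \<le> card A" by simp
    then obtain B where B: "B \<subseteq> A" "card B = 3" by (rule obtain_subset_with_card_n)
    then obtain a b c where "B = {a, b, c}" "a \<noteq> b" "a \<noteq> c" "b \<noteq> c"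
      unfolding card_3_iff by blast
    with B(1) R show False by blast
  qed
qed

lemma ball_set_factor_at: "(\<forall>a\<in>set (factor_at x i n). Q a) \<longleftrightarrow> (\<forall>p. i \<le> p \<and> p < i + n \<longrightarrow> Q (x p))"
  by (auto simp: factor_at_def)

text \<open>A right special factor is named by two positions at which the same window is followed by
  different letters: \<open>p\<close>, \<open>p'\<close> for one factor and \<open>q\<close>,
  \<open>q'\<close> for the other.\<close>

lemma trapezoidal_factor_at_iff:
  "trapezoidal (factor_at x i n) \<longleftrightarrow>
     (\<forall>p. i \<le> p \<and> p < i + n \<longrightarrow> (\<forall>q. i \<le> q \<and> q < i + n \<longrightarrow> (\<forall>r. i \<le> r \<and> r < i + n \<longrightarrow>
        x p = x q \<or> x p = x r \<or> x q = x r))) \<and>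
     (\<forall>m p p' q q'. i \<le> p \<and> p + m < i + n \<and> i \<le> p' \<and> p' + m < i + n \<and>
        i \<le> q \<and> q + m < i + n \<and> i \<le> q' \<and> q' + m < i + n \<and>
        factor_at x p m = factor_at x p' m \<and> \<not> x (p + m) = x (p' + m) \<and>
        factor_at x q m = factor_at x q' m \<and> \<not> x (q + m) = x (q' + m) \<longrightarrow>
        factor_at x p m = factor_at x q m)"
proof -
  have unique: "(\<forall>u\<in>right_specials (factor_at x i n) m. \<forall>v\<in>right_specials (factor_at x i n) m. u = v) \<longleftrightarrow>
     (\<forall>p p' q q'. i \<le> p \<and> p + m < i + n \<and> i \<le> p' \<and> p' + m < i + n \<and>
        i \<le> q \<and> q + m < i + n \<and> i \<le> q' \<and> q' + m < i + n \<and>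
        factor_at x p m = factor_at x p' m \<and> \<not> x (p + m) = x (p' + m) \<and>
        factor_at x q m = factor_at x q' m \<and> \<not> x (q + m) = x (q' + m) \<longrightarrow>
        factor_at x p m = factor_at x q m)" (is "?L \<longleftrightarrow> ?R") for m
  proof
    assume L: ?L
    show ?R
    proof (intro allI impI, elim conjE)
      fix p p' q q'
      assume "i \<le> p" "p + m < i + n" "i \<le> p'" "p' + m < i + n"
        "i \<le> q" "q + m < i + n" "i \<le> q'" "q' + m < i + n"
        "factor_at x p m = factor_at x p' m" "x (p + m) \<noteq> x (p' + m)"
        "factor_at x q m = factor_at x q' m" "x (q + m) \<noteq> x (q' + m)"
      then have "right_special (factor_at x i n) (factor_at x p m)"
        "right_special (factor_at x i n) (factor_at x q m)"
        unfolding right_special_factor_at_iff length_factor_at by metis+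
      with L show "factor_at x p m = factor_at x q m" by simp
    qed
  next
    assume R: ?R
    show ?L
    proof (intro ballI, elim CollectE conjE)
      fix u v assume "right_special (factor_at x i n) u" "length u = m"
        and "right_special (factor_at x i n) v" "length v = m"
      then show "u = v" using R unfolding right_special_factor_at_iff by metis
    qed
  qed
  show ?thesis
    unfolding trapezoidal_iff unique card_le_2_iff[OF finite_set] ball_set_factor_at by simp
qed

theorem mainTheorem1:
  fixes x :: "nat \<Rightarrow> 'a::finite"
  shows "(\<forall>k\<ge>2. k_automatic k x \<longrightarrow>
            (\<forall>P\<in>{closed_word, palindromic, rich, privileged, trapezoidal, balanced}.
               fo_expressible x P)) \<and>
         (fibonacci_automatic x \<longrightarrow>
            (\<forall>P\<in>{closed_word, palindromic, rich, privileged, trapezoidal, balanced}.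
               fo_expressible x P))"
proof -
  \<comment> \<open>Comparing windows letter by letter leaves only sums, order and letter tests,
    from which the closure rules assemble each formula. Variables 0 and 1 hold \<open>i\<close> and
    \<open>n\<close>, and the bound variables start at 3.\<close>
  note factor_at_iffs = palindromic_factor_at_iff factor_at_eq_iff
  have "fo_expressible x closed_word"
    by (rule fo_expressibleI, rule closed_factor_at_iff, unfold factor_at_iffs, intro definable_intros) simp_all
  moreover have "fo_expressible x palindromic"
    by (rule fo_expressibleI, rule palindromic_factor_at_iff, intro definable_intros) simp_all
  moreover have "fo_expressible x rich"
    by (rule fo_expressibleI, rule rich_factor_at_iff, unfold factor_at_iffs, intro definable_intros) simp_all
  moreover have "fo_expressible x privileged"
    by (rule fo_expressibleI, rule privileged_factor_at_iff, unfold privileged_at_def factor_at_iffs, intro definable_intros) simp_all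
  moreover have "fo_expressible x trapezoidal"
    by (rule fo_expressibleI, rule trapezoidal_factor_at_iff, unfold factor_at_iffs, intro definable_intros) simp_all
  moreover have "fo_expressible x balanced"
    by (rule fo_expressibleI, rule balanced_factor_at_iff, intro definable_intros) simp_all
  ultimately show ?thesis by simp
qed

end
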